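(* Let $E$ be a set of elements partitioned into $(E_i)_{i\in[1..n]}$, where $E_i$ is the set of elements that process $p_i$ has the right to delete. Put $C=\{\mathsf{add}_e\}_{e\in E}$, $O_i=\{\mathsf{delete}_e\}_{e\in E_i}$ for $i\in[1..n]$, $\Sigma=C\cup\bigcup_i O_i$, $Q=\{\mathsf{get\_set}\}$, where for a trace $v\in\mathbb{M}(\Sigma)$ and $e\in E$, $\mathsf{get\_set}(v)(e)=|v|_{\mathsf{add}_e}-|v|_{\mathsf{delete}_e}$, with $|v|_x$ the number of occurrences of the letter $x$ in $v$. Let $$L=\{v\in\mathbb{M}(\Sigma)\mid \forall e\in E:\ \mathsf{get\_set}(v)(e)\ge 0\}.$$ Then $(C,(O_j)_{j\in[1..n]},L,Q)$ specifies a Process-Commutative Object; that is, $L$ satisfies Initial emptiness, $C^*$-closure and $I$-diamond closure.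
   Context: Given pairwise disjoint sets of updates $C$ (common updates) and $O_1,\dots,O_n$ ($O_i$ exclusive to process $p_i$), let $\Sigma=C\cup\bigcup_i O_i$, $I=\Sigma\times\Sigma\setminus\bigcup_i(O_i\times O_i)$, let $\sim_I$ be the least congruence on $\Sigma^*$ with $ab\sim_I ba$ for $(a,b)\in I$, and let $\mathbb{M}(\Sigma)=\Sigma^*/{\sim_I}$ be the trace monoid, with concatenation $\oplus$ and empty trace $\epsilon$. A tuple $(C,(O_j)_j,L,Q)$, with $L\subseteq \mathbb{M}(\Sigma)$ and $Q$ a set of query functions $L\to\mathbb{V}$ ($\mathbb{V}$ a set of output values), specifies a Process-Commutative Object if: - *Initial emptiness*: $\epsilon\in L$; - *$C^*$-closure*: if $v\in L$ and $w$ is a trace all of whose letters are in $C$, then $v\oplus w\in L$; - *$I$-diamond closure*: for all $i$, $v\in L$, $\mathsf{op}_i\in O_i$ and every trace $z$ with all letters in $\Sigma\setminus O_i$, if $v\oplus \mathsf{op}_i\in L$ and $v\oplus z\in L$ then $v\oplus z\oplus \mathsf{op}_i\in L$. Updates here are silent (return a constant). The query $\mathsf{get\_set}$ returns the multiplicity map of the multiset. *)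

theory Defs
  imports "HOL-Algebra.Group" "HOL-Library.FuncSet" "HOL-Library.Disjoint_Sets"
begin

section \<open>Trace monoids\<close>

text \<open>The least congruence on the free monoid \<^term>\<open>lists S\<close> that identifies \<open>ab\<close> and \<open>ba\<close>
  for independent \<open>a\<close>, \<open>b\<close>; it is used only with \<open>I \<subseteq> S \<times> S\<close>.\<close>

inductive_set trace_rel :: "'a set \<Rightarrow> ('a \<times> 'a) set \<Rightarrow> ('a list \<times> 'a list) set"
  for S :: "'a set" and I :: "('a \<times> 'a) set"
where
  commute: "(a, b) \<in> I \<Longrightarrow> ([a, b], [b, a]) \<in> trace_rel S I"
| refl: "w \<in> lists S \<Longrightarrow> (w, w) \<in> trace_rel S I"
| sym: "(u, v) \<in> trace_rel S I \<Longrightarrow> (v, u) \<in> trace_rel S I"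
| trans: "(u, v) \<in> trace_rel S I \<Longrightarrow> (v, w) \<in> trace_rel S I \<Longrightarrow> (u, w) \<in> trace_rel S I"
| append: "(u, u') \<in> trace_rel S I \<Longrightarrow> (v, v') \<in> trace_rel S I \<Longrightarrow>
    (u @ v, u' @ v') \<in> trace_rel S I"

definition trace_of :: "'a set \<Rightarrow> ('a \<times> 'a) set \<Rightarrow> 'a list \<Rightarrow> 'a list set" where
  "trace_of S I w = trace_rel S I `` {w}"

definition trace_monoid :: "'a set \<Rightarrow> ('a \<times> 'a) set \<Rightarrow> 'a list set monoid" where
  "trace_monoid S I =
     \<lparr> carrier = lists S // trace_rel S I,
       mult = (\<lambda>x y. \<Union>u\<in>x. \<Union>v\<in>y. trace_of S I (u @ v)),
       one = trace_of S I [] \<rparr>"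

text \<open>All representatives of a trace have the same letters with the same multiplicities, so on
  \<^term>\<open>carrier (trace_monoid S I)\<close> neither function below depends on a choice of
  representative.\<close>

definition trace_letters :: "'a list set \<Rightarrow> 'a set" where
  "trace_letters x = (\<Union>w\<in>x. set w)"

definition trace_count :: "'a list set \<Rightarrow> 'a \<Rightarrow> nat" where
  "trace_count x a = the_elem ((\<lambda>w. count_list w a) ` x)"

lemma trace_rel_lists:
  assumes "(u, v) \<in> trace_rel S I" "I \<subseteq> S \<times> S"
  shows "u \<in> lists S \<and> v \<in> lists S"
  using assms by (induction rule: trace_rel.induct) auto

lemma trace_rel_equiv:
  assumes "I \<subseteq> S \<times> S"
  shows "equiv (lists S) (trace_rel S I)"
proof (rule equivI)
  show "trace_rel S I \<subseteq> lists S \<times> lists S"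
    using trace_rel_lists[OF _ assms] by auto
  show "refl_on (lists S) (trace_rel S I)"
    by (rule refl_onI) (rule trace_rel.refl)
  show "sym (trace_rel S I)"
    by (rule symI) (rule trace_rel.sym)
  show "trans (trace_rel S I)"
    by (rule transI) (rule trace_rel.trans)
qed

lemma trace_of_mult:
  assumes "I \<subseteq> S \<times> S" "u \<in> lists S" "v \<in> lists S"
  shows "trace_of S I u \<otimes>\<^bsub>trace_monoid S I\<^esub> trace_of S I v = trace_of S I (u @ v)"
proof -
  have eq: "trace_of S I (u' @ v') = trace_of S I (u @ v)"
    if "u' \<in> trace_of S I u" "v' \<in> trace_of S I v" for u' v'
  proof -
    have "(u @ v, u' @ v') \<in> trace_rel S I"
      using that by (auto simp: trace_of_def intro: trace_rel.append)
    from equiv_class_eq[OF trace_rel_equiv[OF assms(1)] this] show ?thesis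
      by (simp add: trace_of_def)
  qed
  have mem: "u \<in> trace_of S I u" "v \<in> trace_of S I v"
    using assms(2,3) by (auto simp: trace_of_def intro: trace_rel.refl)
  have "(\<Union>u'\<in>trace_of S I u. \<Union>v'\<in>trace_of S I v. trace_of S I (u' @ v')) =
      trace_of S I (u @ v)"
  proof (rule subset_antisym)
    show "(\<Union>u'\<in>trace_of S I u. \<Union>v'\<in>trace_of S I v. trace_of S I (u' @ v'))
        \<subseteq> trace_of S I (u @ v)"
      by (intro UN_least equalityD1 eq)
    show "trace_of S I (u @ v)
        \<subseteq> (\<Union>u'\<in>trace_of S I u. \<Union>v'\<in>trace_of S I v. trace_of S I (u' @ v'))"
      using mem by blast
  qed
  then show ?thesis
    by (simp add: trace_monoid_def)
qed

lemma trace_rel_count: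
  "(u, v) \<in> trace_rel S I \<Longrightarrow> count_list u a = count_list v a"
  by (induction rule: trace_rel.induct) auto

lemma trace_of_count:
  assumes "w \<in> lists S"
  shows "trace_count (trace_of S I w) a = count_list w a"
proof -
  have "(\<lambda>u. count_list u a) ` trace_of S I w = {count_list w a}"
  proof (intro subset_antisym subsetI)
    fix k assume "k \<in> (\<lambda>u. count_list u a) ` trace_of S I w"
    then obtain u where "(w, u) \<in> trace_rel S I" "k = count_list u a"
      by (auto simp: trace_of_def)
    then show "k \<in> {count_list w a}"
      using trace_rel_count[of w u S I a] by simp
  next
    fix k assume "k \<in> {count_list w a}"
    then show "k \<in> (\<lambda>u. count_list u a) ` trace_of S I w"
      using trace_rel.refl[OF assms] by (simp add: trace_of_def)
  qed
  then show ?thesis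
    by (simp add: trace_count_def)
qed

lemma trace_of_letters:
  assumes "w \<in> lists S"
  shows "trace_letters (trace_of S I w) = set w"
proof -
  have "a \<in> set u \<longleftrightarrow> a \<in> set w" if "(w, u) \<in> trace_rel S I" for u a
    using trace_rel_count[OF that, of a] count_list_0_iff[of u a] count_list_0_iff[of w a] by auto
  then have "set u = set w" if "(w, u) \<in> trace_rel S I" for u
    using that by blast
  moreover have "(w, w) \<in> trace_rel S I"
    using assms by (rule trace_rel.refl)
  ultimately show ?thesis
    unfolding trace_letters_def trace_of_def by blast
qed

lemma trace_carrierE:
  assumes "x \<in> carrier (trace_monoid S I)"
  obtains w where "w \<in> lists S" "x = trace_of S I w"
  using assms by (auto simp: trace_monoid_def trace_of_def elim!: quotientE)

lemma trace_of_carrier: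
  "w \<in> lists S \<Longrightarrow> trace_of S I w \<in> carrier (trace_monoid S I)"
  by (auto simp: trace_monoid_def trace_of_def quotient_def)

lemma trace_monoid_monoid:
  assumes "I \<subseteq> S \<times> S"
  shows "monoid (trace_monoid S I)"
proof -
  let ?M = "trace_monoid S I"
  have one: "\<one>\<^bsub>?M\<^esub> = trace_of S I []"
    by (simp add: trace_monoid_def)
  show ?thesis
  proof (rule monoidI)
    show "\<one>\<^bsub>?M\<^esub> \<in> carrier ?M"
      by (simp add: one trace_of_carrier)
  next
    fix x y assume "x \<in> carrier ?M" "y \<in> carrier ?M"
    then obtain u v where "u \<in> lists S" "x = trace_of S I u" "v \<in> lists S" "y = trace_of S I v"
      by (meson trace_carrierE)
    then show "x \<otimes>\<^bsub>?M\<^esub> y \<in> carrier ?M"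
      by (simp add: trace_of_mult[OF assms] trace_of_carrier)
  next
    fix x y z assume "x \<in> carrier ?M" "y \<in> carrier ?M" "z \<in> carrier ?M"
    then obtain u v w where "u \<in> lists S" "x = trace_of S I u" "v \<in> lists S" "y = trace_of S I v"
      "w \<in> lists S" "z = trace_of S I w"
      by (meson trace_carrierE)
    then show "x \<otimes>\<^bsub>?M\<^esub> y \<otimes>\<^bsub>?M\<^esub> z = x \<otimes>\<^bsub>?M\<^esub> (y \<otimes>\<^bsub>?M\<^esub> z)"
      by (simp add: trace_of_mult[OF assms])
  next
    fix x assume "x \<in> carrier ?M"
    then obtain u where u: "u \<in> lists S" "x = trace_of S I u"
      by (meson trace_carrierE)
    then show "\<one>\<^bsub>?M\<^esub> \<otimes>\<^bsub>?M\<^esub> x = x" "x \<otimes>\<^bsub>?M\<^esub> \<one>\<^bsub>?M\<^esub> = x"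
      by (simp_all add: one trace_of_mult[OF assms])
  qed
qed

section \<open>Process-Commutative Objects\<close>

definition updates :: "nat \<Rightarrow> 'a set \<Rightarrow> (nat \<Rightarrow> 'a set) \<Rightarrow> 'a set" where
  "updates n C X = C \<union> (\<Union>i\<in>{1..n}. X i)"

definition independence :: "nat \<Rightarrow> 'a set \<Rightarrow> (nat \<Rightarrow> 'a set) \<Rightarrow> ('a \<times> 'a) set" where
  "independence n C X = updates n C X \<times> updates n C X - (\<Union>i\<in>{1..n}. X i \<times> X i)"

definition update_traces :: "nat \<Rightarrow> 'a set \<Rightarrow> (nat \<Rightarrow> 'a set) \<Rightarrow> 'a list set monoid" where
  "update_traces n C X = trace_monoid (updates n C X) (independence n C X)"

definition update_trace :: "nat \<Rightarrow> 'a set \<Rightarrow> (nat \<Rightarrow> 'a set) \<Rightarrow> 'a \<Rightarrow> 'a list set" where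
  "update_trace n C X a = trace_of (updates n C X) (independence n C X) [a]"

text \<open>\<open>X i\<close> is the set written \<open>O\<^sub>i\<close> of updates exclusive to process \<open>i\<close>; only the values at
  \<open>i \<in> {1..n}\<close> matter. Queries are extensional functions with domain \<open>L\<close>.\<close>

locale process_commutative_object =
  fixes n :: nat and C :: "'a set" and X :: "nat \<Rightarrow> 'a set"
    and L :: "'a list set set" and V :: "'v set" and Q :: "('a list set \<Rightarrow> 'v) set"
  assumes common_exclusive_disjoint: "\<And>i. i \<in> {1..n} \<Longrightarrow> C \<inter> X i = {}"
    and exclusive_disjoint: "disjoint_family_on X {1..n}"
    and states: "L \<subseteq> carrier (update_traces n C X)"
    and queries: "Q \<subseteq> L \<rightarrow>\<^sub>E V"
    and initial_emptiness: "\<one>\<^bsub>update_traces n C X\<^esub> \<in> L"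
    and common_closure:
      "\<And>v w. \<lbrakk>v \<in> L; w \<in> carrier (update_traces n C X); trace_letters w \<subseteq> C\<rbrakk>
        \<Longrightarrow> v \<otimes>\<^bsub>update_traces n C X\<^esub> w \<in> L"
    and diamond_closure:
      "\<And>i v a z. \<lbrakk>i \<in> {1..n}; v \<in> L; a \<in> X i;
          z \<in> carrier (update_traces n C X); trace_letters z \<subseteq> updates n C X - X i;
          v \<otimes>\<^bsub>update_traces n C X\<^esub> update_trace n C X a \<in> L;
          v \<otimes>\<^bsub>update_traces n C X\<^esub> z \<in> L\<rbrakk>
        \<Longrightarrow> v \<otimes>\<^bsub>update_traces n C X\<^esub> z \<otimes>\<^bsub>update_traces n C X\<^esub> update_trace n C X a \<in> L"

section \<open>Multisets with exclusive deletion rights\<close>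

datatype 'e mset_update = Add 'e | Delete 'e

definition mset_common :: "'e set \<Rightarrow> 'e mset_update set" where
  "mset_common E = Add ` E"

definition mset_exclusive :: "(nat \<Rightarrow> 'e set) \<Rightarrow> nat \<Rightarrow> 'e mset_update set" where
  "mset_exclusive Es i = Delete ` Es i"

definition get_set :: "'e set \<Rightarrow> 'e mset_update list set \<Rightarrow> 'e \<Rightarrow> int" where
  "get_set E v = (\<lambda>e\<in>E. int (trace_count v (Add e)) - int (trace_count v (Delete e)))"

definition mset_states :: "nat \<Rightarrow> 'e set \<Rightarrow> (nat \<Rightarrow> 'e set) \<Rightarrow> 'e mset_update list set set" where
  "mset_states n E Es =
     {v \<in> carrier (update_traces n (mset_common E) (mset_exclusive Es)). \<forall>e\<in>E. get_set E v e \<ge> 0}"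

end

(* The multiplicity get_set is additive over concatenation, and only deletions of e can lower the
   multiplicity of e. A word of additions therefore preserves the states. In a diamond, the only
   element at risk is the one deleted by the exclusive update, and the other branch, which avoids
   the exclusive updates of that process, contains no deletion of it. *)
theory Submission
  imports Defs
begin

text \<open>On representatives the product is concatenation of words, and there occurrences add
  up.\<close>

lemma trace_count_mult:
  assumes "I \<subseteq> S \<times> S" "x \<in> carrier (trace_monoid S I)" "y \<in> carrier (trace_monoid S I)"
  shows "trace_count (x \<otimes>\<^bsub>trace_monoid S I\<^esub> y) a = trace_count x a + trace_count y a"
proof -
  obtain u v where "u \<in> lists S" "x = trace_of S I u" "v \<in> lists S" "y = trace_of S I v"
    using assms(2,3) by (meson trace_carrierE)
  then show ?thesis
    by (simp add: trace_of_mult[OF assms(1)] trace_of_count)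
qed

text \<open>Turns the conditions on letters in the closure properties into statements about
  counts.\<close>

lemma trace_count_eq_0_iff:
  assumes "x \<in> carrier (trace_monoid S I)"
  shows "trace_count x a = 0 \<longleftrightarrow> a \<notin> trace_letters x"
proof -
  obtain w where "w \<in> lists S" "x = trace_of S I w"
    using assms by (rule trace_carrierE)
  then show ?thesis
    by (simp add: trace_of_count trace_of_letters count_list_0_iff)
qed

lemma independence_subset: "independence n C X \<subseteq> updates n C X \<times> updates n C X"
  by (auto simp: independence_def)

lemma update_traces_monoid: "monoid (update_traces n C X)"
  unfolding update_traces_def by (rule trace_monoid_monoid[OF independence_subset])

lemma update_trace_carrier:
  "a \<in> updates n C X \<Longrightarrow> update_trace n C X a \<in> carrier (update_traces n C X)"
  by (simp add: update_trace_def update_traces_def trace_of_carrier)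

lemma trace_count_update_trace:
  "a \<in> updates n C X \<Longrightarrow> trace_count (update_trace n C X a) b = (if a = b then 1 else 0)"
  by (simp add: update_trace_def trace_of_count)

lemma get_set_one:
  "e \<in> E \<Longrightarrow> get_set E \<one>\<^bsub>update_traces n C X\<^esub> e = 0"
  by (simp add: get_set_def update_traces_def trace_monoid_def trace_of_count)

lemma get_set_mult:
  assumes "x \<in> carrier (update_traces n C X)" "y \<in> carrier (update_traces n C X)" "e \<in> E"
  shows "get_set E (x \<otimes>\<^bsub>update_traces n C X\<^esub> y) e = get_set E x e + get_set E y e"
  using assms
  by (simp add: get_set_def update_traces_def trace_count_mult[OF independence_subset])

text \<open>Without the letter \<open>Delete e\<close> the subtracted count is zero. Both closure
  properties rest on this bound for the appended trace.\<close>

lemma get_set_nonneg: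
  assumes "x \<in> carrier (update_traces n C X)" "e \<in> E" "Delete e \<notin> trace_letters x"
  shows "get_set E x e \<ge> 0"
  using assms trace_count_eq_0_iff[of x _ _ "Delete e"]
  by (simp add: get_set_def update_traces_def)

lemma get_set_update_trace_Delete:
  assumes "Delete f \<in> updates n C X" "e \<in> E"
  shows "get_set E (update_trace n C X (Delete f)) e = (if e = f then - 1 else 0)"
  using assms by (simp add: get_set_def trace_count_update_trace)

theorem theorem3:
  fixes E :: "'e set" and Es :: "nat \<Rightarrow> 'e set" and n :: nat
  assumes "E = (\<Union>i\<in>{1..n}. Es i)" and "disjoint_family_on Es {1..n}"
  shows "process_commutative_object n (mset_common E) (mset_exclusive Es)
    (mset_states n E Es) (E \<rightarrow>\<^sub>E {0..}) {restrict (get_set E) (mset_states n E Es)}"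
proof -
  let ?C = "mset_common E" and ?X = "mset_exclusive Es" and ?L = "mset_states n E Es"
  let ?M = "update_traces n ?C ?X"
  \<comment> \<open>Supplies closure of the carrier under products, so that
    \<open>get_set_mult\<close> also applies to the nested product in the diamond.\<close>
  interpret M: monoid ?M
    by (rule update_traces_monoid)
  show ?thesis
  proof
    fix i assume "i \<in> {1..n}"
    show "?C \<inter> ?X i = {}"
      by (auto simp: mset_common_def mset_exclusive_def)
  next
    show "disjoint_family_on ?X {1..n}"
      \<comment> \<open>Disjointness carries over from \<open>Es\<close> because
        \<open>Delete\<close> is injective.\<close>
      using assms(2) by (fastforce simp: disjoint_family_on_def mset_exclusive_def)
  next
    show "?L \<subseteq> carrier ?M"
      by (auto simp: mset_states_def)
  next
    show "{restrict (get_set E) ?L} \<subseteq> ?L \<rightarrow>\<^sub>E E \<rightarrow>\<^sub>E {0..}"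
      \<comment> \<open>On \<open>E\<close>, nonnegativity is the defining condition of the states;
        outside \<open>E\<close>, \<open>get_set\<close> is undefined by its own
        restriction.\<close>
      by (auto simp: mset_states_def) (auto simp: get_set_def)
  next
    show "\<one>\<^bsub>?M\<^esub> \<in> ?L"
      by (simp add: mset_states_def get_set_one)
  next
    fix v w
    assume v: "v \<in> ?L" and w: "w \<in> carrier ?M" "trace_letters w \<subseteq> ?C"
    have "get_set E w e \<ge> 0" if "e \<in> E" for e
      using w that by (intro get_set_nonneg) (auto simp: mset_common_def)
    with v w(1) show "v \<otimes>\<^bsub>?M\<^esub> w \<in> ?L"
      by (simp add: mset_states_def get_set_mult)
  next
    fix i v a z
    assume i: "i \<in> {1..n}" and v: "v \<in> ?L" and a: "a \<in> ?X i"
      and z: "z \<in> carrier ?M" "trace_letters z \<subseteq> updates n ?C ?X - ?X i"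
      and va: "v \<otimes>\<^bsub>?M\<^esub> update_trace n ?C ?X a \<in> ?L" and vz: "v \<otimes>\<^bsub>?M\<^esub> z \<in> ?L"
    obtain f where f: "a = Delete f" "f \<in> Es i"
      using a by (auto simp: mset_exclusive_def)
    have upd: "Delete f \<in> updates n ?C ?X"
      using i f by (auto simp: updates_def mset_exclusive_def)
    note del = update_trace_carrier[OF upd] get_set_update_trace_Delete[OF upd]
    have vM: "v \<in> carrier ?M"
      using v by (simp add: mset_states_def)
    have "get_set E (v \<otimes>\<^bsub>?M\<^esub> z \<otimes>\<^bsub>?M\<^esub> update_trace n ?C ?X a) e \<ge> 0" if e: "e \<in> E" for e
    proof (cases "e = f")
      case True
      \<comment> \<open>Here \<open>Delete e\<close> is the update \<open>a\<close> itself, a letter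
        of \<open>mset_exclusive Es i\<close>, which \<open>z\<close> avoids.\<close>
      have "get_set E z e \<ge> 0"
        using z a e f True by (intro get_set_nonneg) auto
      moreover have "get_set E (v \<otimes>\<^bsub>?M\<^esub> update_trace n ?C ?X a) e \<ge> 0"
        using va e by (simp add: mset_states_def)
      \<comment> \<open>By additivity the multiplicity after \<open>v\<close>, \<open>z\<close>,
        \<open>a\<close> is that after \<open>v\<close>, \<open>a\<close> plus the contribution of
        \<open>z\<close>.\<close>
      ultimately show ?thesis
        using vM z(1) e by (simp add: f(1) get_set_mult del)
    next
      case False
      have "get_set E (v \<otimes>\<^bsub>?M\<^esub> z) e \<ge> 0"
        using vz e by (simp add: mset_states_def)
      \<comment> \<open>Deleting \<open>f\<close> contributes 0 at \<open>e\<close>, so the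
        multiplicity is the one already reached after \<open>v\<close>, \<open>z\<close>.\<close>
      with False show ?thesis
        using vM z(1) e by (simp add: f(1) get_set_mult del)
    qed
    then show "v \<otimes>\<^bsub>?M\<^esub> z \<otimes>\<^bsub>?M\<^esub> update_trace n ?C ?X a \<in> ?L"
      using vM z(1) by (simp add: mset_states_def f(1) del)
  qed
qed

end
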